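(* Let $C$ be a co-Frobenius coalgebra over a field $k$ with a non-degenerate $C^*$-balanced bilinear form $B:C\times C\to k$, and let $\sigma:C\to C$ be the associated Nakayama automorphism. Then $C$ is symmetric if and only if there exists an invertible element $u$ of the algebra $C^*$ such that $\sigma(x)=u^{-1}\cdot x\cdot u$ for all $x\in C$.
   Context: For a coalgebra $C$ over $k$ with $\Delta(x)=\sum x_1\otimes x_2$, the dual $C^*$ is an algebra with the convolution product $(c^*d^* )(x)=\sum c^*(x_1)d^*(x_2)$. $C$ is a $(C^*,C^* )$-bimodule with $c^*\cdot x=\sum c^*(x_2)x_1$ and $x\cdot c^*=\sum c^*(x_1)x_2$; $C^*$ is a bimodule over itself by multiplication. $C$ is symmetric if there exists an injective morphism $C\to C^*$ of $(C^*,C^* )$-bimodules. $C$ is co-Frobenius if there exist an injective morphism of left $C^*$-modules $C\to C^*$ and an injective morphism of right $C^*$-modules $C\to C^*$. A bilinear form $B:C\times C\to k$ is $C^*$-balanced if $B(x\cdot c^*,y)=B(x,c^*\cdot y)$ for all $x,y\in C$, $c^*\in C^*$; non-degenerate if $B(C,y)=0$ implies $y=0$ and $B(y,C)=0$ implies $y=0$. For a co-Frobenius coalgebra $C$ and a non-degenerate $C^*$-balanced form $B$, for every $y\in C$ there is a unique $\sigma(y)\in C$ such that $B(x,y)=B(\sigma(y),x)$ for all $x\in C$. The map $\sigma:C\to C$ is bijective and is called the Nakayama automorphism associated to $B$. *)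

theory Defs
  imports Complex_Main "HOL-Library.Poly_Mapping"
begin

section \<open>Free vector spaces and tensor products\<close>

text \<open>
  The free \<open>'k\<close>-vector space on a type \<open>'a\<close> is \<open>'a \<Rightarrow>\<^sub>0 'k\<close>, the basis vector of \<open>a\<close> being
  \<open>Poly_Mapping.single a 1\<close>.
\<close>

definition free_scale :: "'k::field \<Rightarrow> ('a \<Rightarrow>\<^sub>0 'k) \<Rightarrow> ('a \<Rightarrow>\<^sub>0 'k)" where
  "free_scale c p = Poly_Mapping.map ((*) c) p"

lemma lookup_free_scale: "Poly_Mapping.lookup (free_scale c p) a = c * Poly_Mapping.lookup p a"
  by (simp add: free_scale_def map.rep_eq when_def)

interpretation free: vector_space free_scale
  by unfold_locales
    (auto intro!: poly_mapping_eqI simp: lookup_free_scale lookup_add algebra_simps)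

abbreviation free_basis :: "'a \<Rightarrow> ('a \<Rightarrow>\<^sub>0 'k::field)" where
  "free_basis a \<equiv> Poly_Mapping.single a 1"

text \<open>The linear extension of \<open>f\<close> to the free vector space; \<open>s\<close> is the scalar action on the target.\<close>

definition lin_ext :: "('k::field \<Rightarrow> 'b \<Rightarrow> 'b) \<Rightarrow> ('a \<Rightarrow> 'b::ab_group_add) \<Rightarrow> ('a \<Rightarrow>\<^sub>0 'k) \<Rightarrow> 'b" where
  "lin_ext s f p = (\<Sum>a\<in>Poly_Mapping.keys p. s (Poly_Mapping.lookup p a) (f a))"

definition is_bilinear ::
  "('k::field \<Rightarrow> 'a::ab_group_add \<Rightarrow> 'a) \<Rightarrow> ('k \<Rightarrow> 'b::ab_group_add \<Rightarrow> 'b) \<Rightarrow>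
   ('k \<Rightarrow> 'd::ab_group_add \<Rightarrow> 'd) \<Rightarrow> ('a \<Rightarrow> 'b \<Rightarrow> 'd) \<Rightarrow> bool" where
  "is_bilinear s1 s2 s3 f \<longleftrightarrow>
     (\<forall>x. Vector_Spaces.linear s2 s3 (f x)) \<and> (\<forall>y. Vector_Spaces.linear s1 s3 (\<lambda>x. f x y))"

text \<open>
  For a vector space \<open>C\<close>, the space \<open>C \<otimes> C\<close> is the quotient of the free vector space on \<open>C \<times> C\<close> by
  the span of the bilinearity relations; likewise \<open>C \<otimes> C \<otimes> C\<close> is the quotient of the free vector
  space on \<open>C \<times> C \<times> C\<close> by the span of the trilinearity relations.
\<close>

definition tensor2_rels :: "('k::field \<Rightarrow> 'c::ab_group_add \<Rightarrow> 'c) \<Rightarrow> ('c \<times> 'c \<Rightarrow>\<^sub>0 'k) set" where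
  "tensor2_rels s =
     {free_basis (x + x', y) - free_basis (x, y) - free_basis (x', y) | x x' y. True} \<union>
     {free_basis (x, y + y') - free_basis (x, y) - free_basis (x, y') | x y y'. True} \<union>
     {free_basis (s c x, y) - free_scale c (free_basis (x, y)) | c x y. True} \<union>
     {free_basis (x, s c y) - free_scale c (free_basis (x, y)) | c x y. True}"

definition tensor3_rels :: "('k::field \<Rightarrow> 'c::ab_group_add \<Rightarrow> 'c) \<Rightarrow> ('c \<times> 'c \<times> 'c \<Rightarrow>\<^sub>0 'k) set" where
  "tensor3_rels s =
     {free_basis (x + x', y, z) - free_basis (x, y, z) - free_basis (x', y, z) | x x' y z. True} \<union>
     {free_basis (x, y + y', z) - free_basis (x, y, z) - free_basis (x, y', z) | x y y' z. True} \<union>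
     {free_basis (x, y, z + z') - free_basis (x, y, z) - free_basis (x, y, z') | x y z z'. True} \<union>
     {free_basis (s c x, y, z) - free_scale c (free_basis (x, y, z)) | c x y z. True} \<union>
     {free_basis (x, s c y, z) - free_scale c (free_basis (x, y, z)) | c x y z. True} \<union>
     {free_basis (x, y, s c z) - free_scale c (free_basis (x, y, z)) | c x y z. True}"

definition tensor2_class ::
  "('k::field \<Rightarrow> 'c::ab_group_add \<Rightarrow> 'c) \<Rightarrow> ('c \<times> 'c \<Rightarrow>\<^sub>0 'k) \<Rightarrow> ('c \<times> 'c \<Rightarrow>\<^sub>0 'k) set" where
  "tensor2_class s p = {q. q - p \<in> free.span (tensor2_rels s)}"

definition tensor3_class ::
  "('k::field \<Rightarrow> 'c::ab_group_add \<Rightarrow> 'c) \<Rightarrow> ('c \<times> 'c \<times> 'c \<Rightarrow>\<^sub>0 'k) \<Rightarrow> ('c \<times> 'c \<times> 'c \<Rightarrow>\<^sub>0 'k) set" where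
  "tensor3_class s p = {q. q - p \<in> free.span (tensor3_rels s)}"

text \<open>The underlying set of \<open>C \<otimes> C\<close>.\<close>

definition tensor_square ::
  "('k::field \<Rightarrow> 'c::ab_group_add \<Rightarrow> 'c) \<Rightarrow> ('c \<times> 'c \<Rightarrow>\<^sub>0 'k) set set" where
  "tensor_square s = range (tensor2_class s)"


section \<open>Coalgebras\<close>

text \<open>
  Sweedler notation: \<open>sweedler \<Delta> x\<close> is a chosen formal sum \<open>\<Sum> x\<^sub>1 \<otimes> x\<^sub>2\<close> representing \<open>\<Delta> x\<close>, and
  \<open>sweedler_sum s \<Delta> f x\<close> is \<open>\<Sum> f x\<^sub>1 x\<^sub>2\<close>.  For bilinear \<open>f\<close> the latter does not depend on the choice,
  see \<open>lin_ext_tensor2\<close> below.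
\<close>

definition sweedler :: "('c \<Rightarrow> ('c \<times> 'c \<Rightarrow>\<^sub>0 'k) set) \<Rightarrow> 'c \<Rightarrow> ('c \<times> 'c \<Rightarrow>\<^sub>0 'k::field)" where
  "sweedler \<Delta> x = (SOME p. p \<in> \<Delta> x)"

definition sweedler_sum ::
  "('k::field \<Rightarrow> 'b \<Rightarrow> 'b) \<Rightarrow> ('c \<Rightarrow> ('c \<times> 'c \<Rightarrow>\<^sub>0 'k) set) \<Rightarrow> ('c \<Rightarrow> 'c \<Rightarrow> 'b::ab_group_add) \<Rightarrow> 'c \<Rightarrow> 'b" where
  "sweedler_sum s \<Delta> f x = lin_ext s (\<lambda>(x1, x2). f x1 x2) (sweedler \<Delta> x)"

lemma lin_ext_add:
  assumes "vector_space s"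
  shows "lin_ext s f (p + q) = lin_ext s f p + lin_ext s f q"
proof -
  interpret vector_space s by fact
  have *: "lin_ext s f r = (\<Sum>a\<in>A. s (Poly_Mapping.lookup r a) (f a))"
    if "finite A" "Poly_Mapping.keys r \<subseteq> A" for A r
    unfolding lin_ext_def using that by (intro sum.mono_neutral_left) (auto simp: in_keys_iff)
  let ?A = "Poly_Mapping.keys p \<union> Poly_Mapping.keys q"
  show ?thesis
    using keys_add[of p q]
    by (simp add: *[of ?A] lookup_add scale_left_distrib sum.distrib)
qed

lemma lin_ext_scale:
  assumes "vector_space s"
  shows "lin_ext s f (free_scale c p) = s c (lin_ext s f p)"
proof -
  interpret vector_space s by fact
  have "lin_ext s f (free_scale c p) = (\<Sum>a\<in>Poly_Mapping.keys p. s (Poly_Mapping.lookup (free_scale c p) a) (f a))"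
    unfolding lin_ext_def
    by (intro sum.mono_neutral_left) (auto simp: in_keys_iff lookup_free_scale)
  then show ?thesis
    by (simp add: lin_ext_def lookup_free_scale scale_sum_right)
qed

lemma lin_ext_basis: "vector_space s \<Longrightarrow> lin_ext s f (free_basis a) = f a"
  by (simp add: lin_ext_def vector_space.vector_space_assms(4))

lemma linear_lin_ext: "vector_space s \<Longrightarrow> Vector_Spaces.linear free_scale s (lin_ext s f)"
  by (simp add: Vector_Spaces.linear_iff free.vector_space_axioms lin_ext_add lin_ext_scale)

lemma lin_ext_tensor2:
  assumes f: "is_bilinear s s s' f" and q: "q \<in> tensor2_class s p"
  shows "lin_ext s' (\<lambda>(x, y). f x y) q = lin_ext s' (\<lambda>(x, y). f x y) p"
proof -
  let ?L = "lin_ext s' (\<lambda>(x, y). f x y)"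
  have fl: "Vector_Spaces.linear s s' (f x)" and fr: "Vector_Spaces.linear s s' (\<lambda>x. f x y)" for x y
    using f by (auto simp: is_bilinear_def)
  have vs: "vector_space s'"
    using fl by (simp add: Vector_Spaces.linear_iff)
  interpret L: Vector_Spaces.linear free_scale s' ?L
    by (rule linear_lin_ext) (rule vs)
  have rules: "f x (y + y') = f x y + f x y'" "f x (s c y) = s' c (f x y)"
    "f (x + x') y = f x y + f x' y" "f (s c x) y = s' c (f x y)" for x x' y y' c
    using fl fr by (simp_all add: Vector_Spaces.linear_iff)
  have "?L r = 0" if "r \<in> tensor2_rels s" for r
    using that unfolding tensor2_rels_def
    by (auto simp: L.diff L.scale lin_ext_basis[OF vs] rules)
  then have "?L r = 0" if "r \<in> free.span (tensor2_rels s)" for r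
    using L.eq_0_on_span that by blast
  from this[of "q - p"] q show ?thesis
    by (simp add: tensor2_class_def L.diff)
qed

text \<open>
  A coalgebra structure on the vector space \<open>'c\<close> over \<open>'k\<close>.  The assumptions
  \<open>comult_add\<close> and \<open>comult_scale\<close> say that \<open>\<Delta>\<close> is linear as a map into the quotient \<open>C \<otimes> C\<close>;
  \<open>coassoc\<close> is \<open>(\<Delta> \<otimes> id) \<circ> \<Delta> = (id \<otimes> \<Delta>) \<circ> \<Delta>\<close>.
\<close>

locale coalgebra = vector_space scale
  for scale :: "'k::field \<Rightarrow> 'c::ab_group_add \<Rightarrow> 'c" +
  fixes \<Delta> :: "'c \<Rightarrow> ('c \<times> 'c \<Rightarrow>\<^sub>0 'k) set"
    and \<epsilon> :: "'c \<Rightarrow> 'k"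
  assumes comult_in: "\<Delta> x \<in> tensor_square scale"
    and comult_add: "p \<in> \<Delta> x \<Longrightarrow> q \<in> \<Delta> y \<Longrightarrow> p + q \<in> \<Delta> (x + y)"
    and comult_scale: "p \<in> \<Delta> x \<Longrightarrow> free_scale c p \<in> \<Delta> (scale c x)"
    and counit_linear: "Vector_Spaces.linear scale (*) \<epsilon>"
    and counit_left: "sweedler_sum scale \<Delta> (\<lambda>x1 x2. scale (\<epsilon> x1) x2) x = x"
    and counit_right: "sweedler_sum scale \<Delta> (\<lambda>x1 x2. scale (\<epsilon> x2) x1) x = x"
    and coassoc:
      "tensor3_class scale
         (sweedler_sum free_scale \<Delta>
            (\<lambda>x1 x2. sweedler_sum free_scale \<Delta> (\<lambda>x11 x12. free_basis (x11, x12, x2)) x1) x) =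
       tensor3_class scale
         (sweedler_sum free_scale \<Delta>
            (\<lambda>x1 x2. sweedler_sum free_scale \<Delta> (\<lambda>x21 x22. free_basis (x1, x21, x22)) x2) x)"


section \<open>The dual algebra and its actions\<close>

text \<open>The underlying set of \<open>C\<^sup>*\<close>; the unit of this algebra under \<open>convolution\<close> is \<open>\<epsilon>\<close>.\<close>

definition dual :: "('k::field \<Rightarrow> 'c::ab_group_add \<Rightarrow> 'c) \<Rightarrow> ('c \<Rightarrow> 'k) set" where
  "dual s = {f. Vector_Spaces.linear s (*) f}"

definition convolution ::
  "('c \<Rightarrow> ('c \<times> 'c \<Rightarrow>\<^sub>0 'k) set) \<Rightarrow> ('c \<Rightarrow> 'k::field) \<Rightarrow> ('c \<Rightarrow> 'k) \<Rightarrow> 'c \<Rightarrow> 'k" where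
  "convolution \<Delta> f g = sweedler_sum (*) \<Delta> (\<lambda>x1 x2. f x1 * g x2)"

definition left_act ::
  "('k::field \<Rightarrow> 'c::ab_group_add \<Rightarrow> 'c) \<Rightarrow> ('c \<Rightarrow> ('c \<times> 'c \<Rightarrow>\<^sub>0 'k) set) \<Rightarrow> ('c \<Rightarrow> 'k) \<Rightarrow> 'c \<Rightarrow> 'c" where
  "left_act s \<Delta> f x = sweedler_sum s \<Delta> (\<lambda>x1 x2. s (f x2) x1) x"

definition right_act ::
  "('k::field \<Rightarrow> 'c::ab_group_add \<Rightarrow> 'c) \<Rightarrow> ('c \<Rightarrow> ('c \<times> 'c \<Rightarrow>\<^sub>0 'k) set) \<Rightarrow> 'c \<Rightarrow> ('c \<Rightarrow> 'k) \<Rightarrow> 'c" where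
  "right_act s \<Delta> x f = sweedler_sum s \<Delta> (\<lambda>x1 x2. s (f x1) x2) x"

text \<open>A map \<open>C \<rightarrow> C\<^sup>*\<close> has type \<open>'c \<Rightarrow> 'c \<Rightarrow> 'k\<close>; its linearity is stated pointwise.\<close>

definition linear_to_dual ::
  "('k::field \<Rightarrow> 'c::ab_group_add \<Rightarrow> 'c) \<Rightarrow> ('c \<Rightarrow> 'c \<Rightarrow> 'k) \<Rightarrow> bool" where
  "linear_to_dual s \<phi> \<longleftrightarrow>
     (\<forall>x. \<phi> x \<in> dual s) \<and> (\<forall>z. Vector_Spaces.linear s (*) (\<lambda>x. \<phi> x z))"

definition left_module_hom ::
  "('k::field \<Rightarrow> 'c::ab_group_add \<Rightarrow> 'c) \<Rightarrow> ('c \<Rightarrow> ('c \<times> 'c \<Rightarrow>\<^sub>0 'k) set) \<Rightarrow> ('c \<Rightarrow> 'c \<Rightarrow> 'k) \<Rightarrow> bool" where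
  "left_module_hom s \<Delta> \<phi> \<longleftrightarrow> linear_to_dual s \<phi> \<and>
     (\<forall>f\<in>dual s. \<forall>x. \<phi> (left_act s \<Delta> f x) = convolution \<Delta> f (\<phi> x))"

definition right_module_hom ::
  "('k::field \<Rightarrow> 'c::ab_group_add \<Rightarrow> 'c) \<Rightarrow> ('c \<Rightarrow> ('c \<times> 'c \<Rightarrow>\<^sub>0 'k) set) \<Rightarrow> ('c \<Rightarrow> 'c \<Rightarrow> 'k) \<Rightarrow> bool" where
  "right_module_hom s \<Delta> \<phi> \<longleftrightarrow> linear_to_dual s \<phi> \<and>
     (\<forall>f\<in>dual s. \<forall>x. \<phi> (right_act s \<Delta> x f) = convolution \<Delta> (\<phi> x) f)"

definition symmetric_coalgebra ::
  "('k::field \<Rightarrow> 'c::ab_group_add \<Rightarrow> 'c) \<Rightarrow> ('c \<Rightarrow> ('c \<times> 'c \<Rightarrow>\<^sub>0 'k) set) \<Rightarrow> bool" where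
  "symmetric_coalgebra s \<Delta> \<longleftrightarrow>
     (\<exists>\<phi>. left_module_hom s \<Delta> \<phi> \<and> right_module_hom s \<Delta> \<phi> \<and> inj \<phi>)"

definition co_frobenius ::
  "('k::field \<Rightarrow> 'c::ab_group_add \<Rightarrow> 'c) \<Rightarrow> ('c \<Rightarrow> ('c \<times> 'c \<Rightarrow>\<^sub>0 'k) set) \<Rightarrow> bool" where
  "co_frobenius s \<Delta> \<longleftrightarrow>
     (\<exists>\<phi>. left_module_hom s \<Delta> \<phi> \<and> inj \<phi>) \<and> (\<exists>\<psi>. right_module_hom s \<Delta> \<psi> \<and> inj \<psi>)"


section \<open>Balanced forms and the Nakayama automorphism\<close>

definition balanced ::
  "('k::field \<Rightarrow> 'c::ab_group_add \<Rightarrow> 'c) \<Rightarrow> ('c \<Rightarrow> ('c \<times> 'c \<Rightarrow>\<^sub>0 'k) set) \<Rightarrow> ('c \<Rightarrow> 'c \<Rightarrow> 'k) \<Rightarrow> bool" where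
  "balanced s \<Delta> B \<longleftrightarrow>
     (\<forall>x y. \<forall>f\<in>dual s. B (right_act s \<Delta> x f) y = B x (left_act s \<Delta> f y))"

definition non_degenerate :: "('c::zero \<Rightarrow> 'c \<Rightarrow> 'k::zero) \<Rightarrow> bool" where
  "non_degenerate B \<longleftrightarrow>
     (\<forall>y. (\<forall>x. B x y = 0) \<longrightarrow> y = 0) \<and> (\<forall>y. (\<forall>x. B y x = 0) \<longrightarrow> y = 0)"

definition nakayama :: "('c \<Rightarrow> 'c \<Rightarrow> 'k) \<Rightarrow> 'c \<Rightarrow> 'c" where
  "nakayama B y = (THE z. \<forall>x. B x y = B z x)"

end

theory Submission
  imports Defs
begin

text \<open>
  The form \<open>B\<close> gives two maps \<open>C \<rightarrow> C\<^sup>*\<close>, \<open>R x = B(x, -)\<close> and \<open>L y = B(-, y)\<close>.  Because \<open>B\<close> is balanced,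
  \<open>R\<close> is a morphism of right modules and \<open>L\<close> one of left modules, and the Nakayama automorphism is
  the comparison between them: \<open>L y = R (\<sigma> y)\<close>.

  The image of \<open>L\<close> lies in that of \<open>R\<close> because of local units.  The action of \<open>C\<^sup>*\<close> on a fixed \<open>y\<close>
  only sees the values of a functional at the finitely many \<open>y\<^sub>2\<close>, and non-degeneracy gives a \<open>w\<close>
  for which \<open>R w\<close> takes the same values there as \<open>\<epsilon>\<close>.  Then \<open>R w \<cdot> y = y\<close>, and
  \<open>L y = L (R w \<cdot> y) = R w * L y = R (w \<cdot> L y)\<close> (lemma \<open>right_form_in_left_range\<close>).  The argument
  allows two different forms on the two sides, and this is used again below.

  If \<open>\<sigma> x = v \<cdot> x \<cdot> u\<close> with \<open>v = u\<^sup>-\<^sup>1\<close>, then \<open>R (v \<cdot> x) * u = L x\<close>, so \<open>R (v \<cdot> x) = L x * v\<close>: one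
  description shows that this is right linear in \<open>x\<close>, the other that it is left linear, and it is
  injective since \<open>v\<close> is invertible.

  Conversely let \<open>\<phi>\<close> be an injective bimodule morphism.  It is automatically a symmetric form
  (lemma \<open>bimodule_embedding_symmetric\<close>), hence non-degenerate on both sides.  The comparison of
  images applied to \<open>\<phi>\<close> and \<open>B\<close>, in both orders, gives \<open>L y = \<phi> (c y)\<close> and \<open>\<phi> x = R (a x)\<close>, where \<open>c\<close>
  is left linear and \<open>a\<close> is right linear; such maps are the right action of some \<open>u \<in> C\<^sup>*\<close> and the
  left action of some \<open>v \<in> C\<^sup>*\<close>.  By symmetry of \<open>\<phi>\<close>, the equation \<open>L y = \<phi> (y \<cdot> u)\<close> also says
  \<open>R x = \<phi> (u \<cdot> x)\<close>, so \<open>u\<close> and \<open>v\<close> are inverse to each other, and \<open>R (\<sigma> y) = L y = R (v \<cdot> (y \<cdot> u))\<close>.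
\<close>

section \<open>Dual vectors\<close>

context vector_space
begin

lemma dual_iff:
  "f \<in> dual scale \<longleftrightarrow> (\<forall>x y. f (x + y) = f x + f y) \<and> (\<forall>c x. f (scale c x) = c * f x)"
proof -
  have "vector_space ((*) :: 'a \<Rightarrow> 'a \<Rightarrow> 'a)"
    by unfold_locales (auto simp: algebra_simps)
  then show ?thesis
    by (simp add: dual_def Vector_Spaces.linear_iff vector_space_axioms)
qed

lemma dual_separates:
  assumes "\<And>f. f \<in> dual scale \<Longrightarrow> f x = f y"
  shows "x = y"
proof (rule ccontr)
  assume "x \<noteq> y"
  interpret pair: vector_space_pair scale "(*) :: 'a \<Rightarrow> 'a \<Rightarrow> 'a"
    by unfold_locales (auto simp: algebra_simps)
  have "independent {x - y}"
    using \<open>x \<noteq> y\<close> by (simp add: dependent_single)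
  from pair.linear_independent_extend[OF this, of "\<lambda>_. 1"]
  obtain g where g: "Vector_Spaces.linear scale (*) g" "g (x - y) = 1"
    by auto
  then have "g \<in> dual scale" by (simp add: dual_def)
  moreover have "g x = g (x - y) + g y"
    using \<open>g \<in> dual scale\<close> unfolding dual_iff by (metis diff_add_cancel)
  ultimately show False
    using assms[of g] g(2) by simp
qed

text \<open>
  The pairing version of the fact that a functional that vanishes on the intersection of the kernels
  of finitely many functionals is a linear combination of them.  The induction subtracts from \<open>p\<close> the
  multiple of \<open>B(-, s)\<close>, with \<open>s\<close> the added vector, that agrees with it at some \<open>t0\<close> orthogonal to \<open>S\<close>.
\<close>

lemma functional_in_pairing_span:
  assumes B: "is_bilinear scale scale (*) B" and "finite S" and "p \<in> dual scale"
    and "\<And>t. (\<forall>s\<in>S. B t s = 0) \<Longrightarrow> p t = 0"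
  shows "\<exists>v\<in>span S. \<forall>t. p t = B t v"
  using assms(2-)
proof (induction S arbitrary: p rule: finite_induct)
  case empty
  have "B t 0 = 0" for t
    using B unfolding is_bilinear_def by (metis Vector_Spaces.linear_iff mult_zero_left scale_zero_left)
  then show ?case using empty by (intro bexI[of _ 0]) auto
next
  case (insert s S)
  have Bl: "B (x + x') y = B x y + B x' y" "B (scale c x) y = c * B x y"
    and Br: "B x (y + y') = B x y + B x y'" "B x (scale c y) = c * B x y" for x x' y y' c
    using B unfolding is_bilinear_def by (auto simp: Vector_Spaces.linear_iff)
  have p: "p (x + x') = p x + p x'" "p (scale c x) = c * p x" for x x' c
    using insert.prems(1) unfolding dual_iff by auto
  show ?case
  proof (cases "\<forall>t. (\<forall>s\<in>S. B t s = 0) \<longrightarrow> p t = 0")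
    case True
    then obtain v where "v \<in> span S" "\<forall>t. p t = B t v"
      using insert.IH[OF insert.prems(1)] by auto
    then show ?thesis
      using span_mono[of S "insert s S"] by blast
  next
    case False
    then obtain t0 where t0: "\<forall>s\<in>S. B t0 s = 0" "p t0 \<noteq> 0" by auto
    then have Bs: "B t0 s \<noteq> 0" using insert.prems(2)[of t0] by auto
    define c where "c = p t0 / B t0 s"
    define p' where "p' t = p t - c * B t s" for t
    have "p' \<in> dual scale"
      unfolding dual_iff p'_def by (simp add: p Bl algebra_simps)
    moreover have "p' t = 0" if "\<forall>s\<in>S. B t s = 0" for t
    proof -
      define d where "d = - B t s / B t0 s"
      have "B (t + scale d t0) r = 0" if "r \<in> insert s S" for r
        using that \<open>\<forall>s\<in>S. B t s = 0\<close> t0 Bs by (auto simp only: Bl d_def) (auto simp: field_simps)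
      then have "p (t + scale d t0) = 0" by (intro insert.prems(2)) auto
      then have "p t + d * p t0 = 0" by (simp only: p)
      then show ?thesis
        using Bs by (simp add: p'_def c_def d_def field_simps)
    qed
    ultimately obtain v where v: "v \<in> span S" "\<forall>t. p' t = B t v"
      using insert.IH by blast
    have "v + scale c s \<in> span (insert s S)"
      using v(1) span_mono[of S "insert s S"] by (intro span_add span_scale) (auto intro: span_base)
    moreover have "\<forall>t. p t = B t (v + scale c s)"
      using v(2) by (simp add: Br p'_def algebra_simps)
    ultimately show ?thesis by blast
  qed
qed

text \<open>
  Density of the functionals \<open>B w\<close> in the finite topology of the dual space.  Applied to \<open>h = \<epsilon>\<close>,
  it supplies the local units.
\<close>

lemma interpolation_by_pairing:
  assumes B: "is_bilinear scale scale (*) B" and nd: "\<And>y. (\<forall>x. B x y = 0) \<Longrightarrow> y = 0"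
    and h: "h \<in> dual scale" and "finite S"
  shows "\<exists>w. \<forall>s\<in>S. B w s = h s"
  using \<open>finite S\<close>
proof (induction S rule: finite_induct)
  case empty
  then show ?case by simp
next
  case (insert s S)
  then obtain w where w: "\<forall>s\<in>S. B w s = h s" by auto
  have Bl: "B (x + x') y = B x y + B x' y" "B (scale c x) y = c * B x y"
    and Br: "B x (y + y') = B x y + B x y'" "B x (scale c y) = c * B x y" for x x' y y' c
    using B unfolding is_bilinear_def by (auto simp: Vector_Spaces.linear_iff)
  show ?case
  proof (cases "\<exists>t. (\<forall>s\<in>S. B t s = 0) \<and> B t s \<noteq> 0")
    case True
    then obtain t where t: "\<forall>s\<in>S. B t s = 0" "B t s \<noteq> 0" by auto
    have "\<forall>s'\<in>insert s S. B (w + scale ((h s - B w s) / B t s) t) s' = h s'"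
      using t w by (auto simp: Bl)
    then show ?thesis by blast
  next
    (* Then s is a linear combination of S, so the value at s is forced and already correct. *)
    case False
    have "(\<lambda>x. B x s) \<in> dual scale" by (simp add: dual_iff Bl)
    then obtain v where v: "v \<in> span S" "\<forall>t. B t s = B t v"
      using functional_in_pairing_span[OF B insert.hyps(1)] False by blast
    have minus: "B t (s - v) = B t s - B t v" for t
      using Br(1)[of t "s - v" v] by simp
    have "s = v"
      using nd[of "s - v"] v(2) minus by auto
    have "B w v = h v"
    proof (rule vector_space_pair.linear_eq_on[OF _ _ _ v(1)])
      show "vector_space_pair scale ((*) :: 'a \<Rightarrow> 'a \<Rightarrow> 'a)"
        by unfold_locales (auto simp: algebra_simps)
      show "Vector_Spaces.linear scale (*) (B w)"
        using B by (simp add: is_bilinear_def)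
      show "Vector_Spaces.linear scale (*) h"
        using h by (simp add: dual_def)
    qed (use w in auto)
    then show ?thesis
      using w \<open>s = v\<close> by auto
  qed
qed

end


section \<open>Convolution and the two actions\<close>

lemma linear_sweedler_sum:
  assumes "Vector_Spaces.linear s s' h"
  shows "h (sweedler_sum s \<Delta> f x) = sweedler_sum s' \<Delta> (\<lambda>x1 x2. h (f x1 x2)) x"
proof -
  interpret Vector_Spaces.linear s s' h by fact
  show ?thesis
    unfolding sweedler_sum_def lin_ext_def by (auto simp: sum scale intro!: sum.cong)
qed

context coalgebra
begin

lemma vector_space_field: "vector_space ((*) :: 'k \<Rightarrow> 'k \<Rightarrow> 'k)"
  by unfold_locales (auto simp: algebra_simps)

lemma linear_mult_left: "Vector_Spaces.linear (*) (*) ((*) (c :: 'k))"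
  and linear_mult_right: "Vector_Spaces.linear (*) (*) (\<lambda>x. x * (c :: 'k))"
  by (simp_all add: Vector_Spaces.linear_iff vector_space_field algebra_simps)

lemma comult_class_diff:
  assumes "p \<in> \<Delta> x" "q \<in> \<Delta> x"
  shows "q \<in> tensor2_class scale p"
proof -
  obtain r where r: "\<Delta> x = tensor2_class scale r"
    using comult_in[of x] by (auto simp: tensor_square_def)
  have "(q - r) - (p - r) \<in> free.span (tensor2_rels scale)"
    using assms unfolding r tensor2_class_def by (blast intro: free.span_diff)
  then show ?thesis by (simp add: tensor2_class_def)
qed

lemma sweedler_in: "sweedler \<Delta> x \<in> \<Delta> x"
proof -
  obtain r where "\<Delta> x = tensor2_class scale r"
    using comult_in[of x] by (auto simp: tensor_square_def)
  then have "r \<in> \<Delta> x" by (simp add: tensor2_class_def free.span_zero)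
  then show ?thesis unfolding sweedler_def by (rule someI)
qed

lemma sweedler_sum_dual:
  assumes f: "is_bilinear scale scale (*) f"
  shows "sweedler_sum (*) \<Delta> f \<in> dual scale"
proof -
  note vs = vector_space_field
  have "sweedler_sum (*) \<Delta> f (x + y) = sweedler_sum (*) \<Delta> f x + sweedler_sum (*) \<Delta> f y" for x y
    using lin_ext_tensor2[OF f comult_class_diff[OF comult_add[OF sweedler_in sweedler_in] sweedler_in], of x y]
    by (simp add: sweedler_sum_def lin_ext_add[OF vs])
  moreover have "sweedler_sum (*) \<Delta> f (scale c x) = c * sweedler_sum (*) \<Delta> f x" for c x
    using lin_ext_tensor2[OF f comult_class_diff[OF comult_scale[OF sweedler_in] sweedler_in], of c x]
    by (simp add: sweedler_sum_def lin_ext_scale[OF vs])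
  ultimately show ?thesis by (simp add: dual_iff)
qed

lemma convolution_dual:
  assumes "f \<in> dual scale" "g \<in> dual scale"
  shows "convolution \<Delta> f g \<in> dual scale"
  unfolding convolution_def
  using assms
  by (intro sweedler_sum_dual)
     (auto simp: is_bilinear_def Vector_Spaces.linear_iff vector_space_axioms vector_space_field
       dual_iff algebra_simps)

lemma counit_dual: "\<epsilon> \<in> dual scale"
  using counit_linear by (simp add: dual_def)

text \<open>
  A product of three functionals is trilinear, so it can be evaluated on a threefold tensor through
  any representative.  Such evaluations turn coassociativity into associativity of convolution.
\<close>

lemma lin_ext_tensor3_eq:
  assumes f: "f \<in> dual scale" and g: "g \<in> dual scale" and h: "h \<in> dual scale"
    and eq: "tensor3_class scale p = tensor3_class scale q"
  shows "lin_ext (*) (\<lambda>(x, y, z). f x * g y * h z) p = lin_ext (*) (\<lambda>(x, y, z). f x * g y * h z) q"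
proof -
  define T where "T x y z = f x * g y * h z" for x y z
  let ?L = "lin_ext (*) (\<lambda>(x, y, z). T x y z)"
  note vs = vector_space_field
  have dual_rules: "k (x + y) = k x + k y" "k (scale c x) = c * k x" if "k \<in> dual scale" for k x y c
    using that by (simp_all add: dual_iff)
  have T: "T (x + x') y z = T x y z + T x' y z" "T x (y + y') z = T x y z + T x y' z"
    "T x y (z + z') = T x y z + T x y z'" "T (scale c x) y z = c * T x y z"
    "T x (scale c y) z = c * T x y z" "T x y (scale c z) = c * T x y z" for x x' y y' z z' c
    unfolding T_def dual_rules[OF f] dual_rules[OF g] dual_rules[OF h] by (simp_all add: algebra_simps)
  interpret L: Vector_Spaces.linear free_scale "(*)" ?L
    by (rule linear_lin_ext) (rule vs)
  have "?L r = 0" if "r \<in> tensor3_rels scale" for r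
    using that unfolding tensor3_rels_def
    by (auto simp: L.diff L.scale lin_ext_basis[OF vs] T)
  then have 0: "?L r = 0" if "r \<in> free.span (tensor3_rels scale)" for r
    using L.eq_0_on_span that by blast
  have "p \<in> tensor3_class scale q"
    unfolding eq[symmetric] by (simp add: tensor3_class_def free.span_zero)
  then have "?L p = ?L q"
    using 0[of "p - q"] by (simp add: tensor3_class_def L.diff)
  then show ?thesis
    by (simp add: T_def)
qed

lemma convolution_assoc:
  assumes f: "f \<in> dual scale" and g: "g \<in> dual scale" and h: "h \<in> dual scale"
  shows "convolution \<Delta> (convolution \<Delta> f g) h = convolution \<Delta> f (convolution \<Delta> g h)"
proof
  fix x
  let ?L = "lin_ext (*) (\<lambda>(x, y, z). f x * g y * h z)"
  note vs = vector_space_field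
  note L = linear_lin_ext[OF vs]
  note eval = linear_sweedler_sum[OF L] lin_ext_basis[OF vs]
  have "convolution \<Delta> (convolution \<Delta> f g) h x = sweedler_sum (*) \<Delta>
      (\<lambda>x1 x2. sweedler_sum (*) \<Delta> (\<lambda>x11 x12. f x11 * g x12 * h x2) x1) x"
    unfolding convolution_def by (subst linear_sweedler_sum[OF linear_mult_right]) simp
  also have "\<dots> = ?L (sweedler_sum free_scale \<Delta>
      (\<lambda>x1 x2. sweedler_sum free_scale \<Delta> (\<lambda>x11 x12. free_basis (x11, x12, x2)) x1) x)"
    by (simp add: eval)
  also have "\<dots> = ?L (sweedler_sum free_scale \<Delta>
      (\<lambda>x1 x2. sweedler_sum free_scale \<Delta> (\<lambda>x21 x22. free_basis (x1, x21, x22)) x2) x)"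
    by (rule lin_ext_tensor3_eq[OF f g h coassoc])
  also have "\<dots> = sweedler_sum (*) \<Delta>
      (\<lambda>x1 x2. sweedler_sum (*) \<Delta> (\<lambda>x21 x22. f x1 * (g x21 * h x22)) x2) x"
    by (simp add: eval mult.assoc)
  also have "\<dots> = convolution \<Delta> f (convolution \<Delta> g h) x"
    unfolding convolution_def by (subst linear_sweedler_sum[OF linear_mult_left]) simp
  finally show "convolution \<Delta> (convolution \<Delta> f g) h x = convolution \<Delta> f (convolution \<Delta> g h) x" .
qed

text \<open>
  Evaluating a functional on a translate is a convolution.  Since functionals separate points, every
  law of the two actions therefore reduces to an identity in the dual algebra.
\<close>

lemma dual_left_act:
  assumes "f \<in> dual scale"
  shows "f (left_act scale \<Delta> g x) = convolution \<Delta> f g x"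
proof -
  have f: "Vector_Spaces.linear scale (*) f"
    using assms by (simp add: dual_def)
  have fs: "f (scale c y) = f y * c" for c y
    using assms unfolding dual_iff by (metis mult.commute)
  show ?thesis
    by (simp only: left_act_def convolution_def linear_sweedler_sum[OF f] fs)
qed

lemma dual_right_act:
  assumes "f \<in> dual scale"
  shows "f (right_act scale \<Delta> x g) = convolution \<Delta> g f x"
proof -
  have f: "Vector_Spaces.linear scale (*) f"
    using assms by (simp add: dual_def)
  have fs: "f (scale c y) = c * f y" for c y
    using assms by (simp add: dual_iff)
  show ?thesis
    by (simp only: right_act_def convolution_def linear_sweedler_sum[OF f] fs)
qed

lemma left_act_counit: "left_act scale \<Delta> \<epsilon> x = x"
  using counit_right by (simp add: left_act_def)

lemma right_act_counit: "right_act scale \<Delta> x \<epsilon> = x"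
  using counit_left by (simp add: right_act_def)

lemma convolution_counit_right:
  assumes "f \<in> dual scale"
  shows "convolution \<Delta> f \<epsilon> = f"
  using dual_left_act[OF assms, of \<epsilon>] by (simp add: left_act_counit fun_eq_iff)

lemma convolution_counit_left:
  assumes "f \<in> dual scale"
  shows "convolution \<Delta> \<epsilon> f = f"
  using dual_right_act[OF assms, of _ \<epsilon>] by (simp add: right_act_counit fun_eq_iff)

lemma counit_left_act:
  assumes "f \<in> dual scale"
  shows "\<epsilon> (left_act scale \<Delta> f x) = f x"
  by (simp add: dual_left_act counit_dual convolution_counit_left assms)

lemma counit_right_act:
  assumes "f \<in> dual scale"
  shows "\<epsilon> (right_act scale \<Delta> x f) = f x"
  by (simp add: dual_right_act counit_dual convolution_counit_right assms)

lemma left_act_left_act: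
  assumes "f \<in> dual scale" "g \<in> dual scale"
  shows "left_act scale \<Delta> f (left_act scale \<Delta> g x) = left_act scale \<Delta> (convolution \<Delta> f g) x"
  by (rule dual_separates) (simp add: dual_left_act convolution_dual convolution_assoc assms)

lemma left_act_right_act:
  assumes "f \<in> dual scale" "g \<in> dual scale"
  shows "right_act scale \<Delta> (left_act scale \<Delta> f x) g = left_act scale \<Delta> f (right_act scale \<Delta> x g)"
  by (rule dual_separates)
    (simp add: dual_left_act dual_right_act convolution_dual convolution_assoc assms)

lemma linear_left_act:
  assumes "f \<in> dual scale"
  shows "left_act scale \<Delta> f (x + y) = left_act scale \<Delta> f x + left_act scale \<Delta> f y"
    and "left_act scale \<Delta> f (scale c x) = scale c (left_act scale \<Delta> f x)"
proof -
  have *: "h (a + b) = h a + h b" "h (scale c a) = c * h a" if "h \<in> dual scale" for h a b c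
    using that by (simp_all add: dual_iff)
  note conv = *[OF convolution_dual[OF _ assms]]
  show "left_act scale \<Delta> f (x + y) = left_act scale \<Delta> f x + left_act scale \<Delta> f y"
    by (rule dual_separates) (simp add: * dual_left_act conv)
  show "left_act scale \<Delta> f (scale c x) = scale c (left_act scale \<Delta> f x)"
    by (rule dual_separates) (simp add: * dual_left_act conv)
qed

text \<open>A functional is read by the action on \<open>y\<close> only at the finitely many \<open>y\<^sub>2\<close>.\<close>

lemma left_act_eq_self:
  assumes "\<And>z. z \<in> snd ` Poly_Mapping.keys (sweedler \<Delta> y) \<Longrightarrow> g z = \<epsilon> z"
  shows "left_act scale \<Delta> g y = y"
proof -
  have "left_act scale \<Delta> g y = left_act scale \<Delta> \<epsilon> y"
    unfolding left_act_def sweedler_sum_def lin_ext_def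
    using assms by (intro sum.cong) (auto simp: image_iff split: prod.splits, metis snd_conv)
  then show ?thesis by (simp add: left_act_counit)
qed

text \<open>
  A right linear endomorphism \<open>a\<close> is determined by \<open>\<epsilon> \<circ> a\<close>, because \<open>f (a x) = \<epsilon> (a x \<cdot> f) = \<epsilon> (a (x \<cdot> f))\<close>
  for every functional \<open>f\<close>; the mirror image holds for left linear ones.
\<close>

lemma right_linear_endomorphism:
  assumes "\<epsilon> \<circ> a \<in> dual scale"
    and "\<And>x f. f \<in> dual scale \<Longrightarrow> a (right_act scale \<Delta> x f) = right_act scale \<Delta> (a x) f"
  shows "a x = left_act scale \<Delta> (\<epsilon> \<circ> a) x"
proof (rule dual_separates)
  fix f assume f: "f \<in> dual scale"
  have "f (a x) = (\<epsilon> \<circ> a) (right_act scale \<Delta> x f)"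
    by (simp add: assms(2) f counit_right_act)
  also have "\<dots> = f (left_act scale \<Delta> (\<epsilon> \<circ> a) x)"
    by (simp only: dual_right_act[OF assms(1)] dual_left_act[OF f])
  finally show "f (a x) = f (left_act scale \<Delta> (\<epsilon> \<circ> a) x)" .
qed

lemma left_linear_endomorphism:
  assumes "\<epsilon> \<circ> a \<in> dual scale"
    and "\<And>x f. f \<in> dual scale \<Longrightarrow> a (left_act scale \<Delta> f x) = left_act scale \<Delta> f (a x)"
  shows "a x = right_act scale \<Delta> x (\<epsilon> \<circ> a)"
proof (rule dual_separates)
  fix f assume f: "f \<in> dual scale"
  have "f (a x) = (\<epsilon> \<circ> a) (left_act scale \<Delta> f x)"
    by (simp add: assms(2) f counit_left_act)
  also have "\<dots> = f (right_act scale \<Delta> x (\<epsilon> \<circ> a))"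
    by (simp only: dual_left_act[OF assms(1)] dual_right_act[OF f])
  finally show "f (a x) = f (right_act scale \<Delta> x (\<epsilon> \<circ> a))" .
qed


section \<open>Balanced forms\<close>

lemma bilinear_form_dual:
  assumes "is_bilinear scale scale (*) B"
  shows "B x \<in> dual scale" and "(\<lambda>x. B x y) \<in> dual scale"
  using assms by (simp_all add: is_bilinear_def dual_def)

lemma linear_to_dual_bilinear: "linear_to_dual scale \<phi> \<longleftrightarrow> is_bilinear scale scale (*) \<phi>"
  by (simp add: linear_to_dual_def is_bilinear_def dual_def)

lemma balanced_right_act:
  assumes "is_bilinear scale scale (*) B" "balanced scale \<Delta> B" "f \<in> dual scale"
  shows "B (right_act scale \<Delta> x f) = convolution \<Delta> (B x) f"
  using assms by (auto simp: balanced_def dual_left_act bilinear_form_dual)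

lemma balanced_left_act:
  assumes "is_bilinear scale scale (*) B" "balanced scale \<Delta> B" "f \<in> dual scale"
  shows "(\<lambda>x. B x (left_act scale \<Delta> f y)) = convolution \<Delta> f (\<lambda>x. B x y)"
proof
  fix x
  have "B x (left_act scale \<Delta> f y) = B (right_act scale \<Delta> x f) y"
    using assms by (simp add: balanced_def)
  then show "B x (left_act scale \<Delta> f y) = convolution \<Delta> f (\<lambda>x. B x y) x"
    by (simp add: dual_right_act[OF bilinear_form_dual(2)[OF assms(1)]])
qed

lemma right_module_hom_balanced:
  assumes "right_module_hom scale \<Delta> \<phi>"
  shows "balanced scale \<Delta> \<phi>"
  using assms by (auto simp: right_module_hom_def linear_to_dual_def balanced_def dual_left_act)

text \<open>
  The local unit argument: a functional \<open>B' w\<close> that agrees with \<open>\<epsilon>\<close> on the \<open>y\<^sub>2\<close> fixes \<open>y\<close>, and then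
  it can be pulled out of \<open>B(-, y)\<close> as a left factor.
\<close>

lemma right_form_in_left_range:
  assumes B: "is_bilinear scale scale (*) B" "balanced scale \<Delta> B"
    and B': "is_bilinear scale scale (*) B'" "balanced scale \<Delta> B'"
    and nd: "\<And>y. (\<forall>x. B' x y = 0) \<Longrightarrow> y = 0"
  shows "\<exists>z. \<forall>x. B x y = B' z x"
proof -
  let ?L = "\<lambda>x. B x y"
  obtain w where w: "\<And>s. s \<in> snd ` Poly_Mapping.keys (sweedler \<Delta> y) \<Longrightarrow> B' w s = \<epsilon> s"
    using interpolation_by_pairing[OF B'(1) nd counit_dual, of "snd ` Poly_Mapping.keys (sweedler \<Delta> y)"]
    by auto
  have "?L = (\<lambda>x. B x (left_act scale \<Delta> (B' w) y))"
    using left_act_eq_self[OF w] by simp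
  also have "\<dots> = convolution \<Delta> (B' w) ?L"
    by (rule balanced_left_act[OF B bilinear_form_dual(1)[OF B'(1)]])
  also have "\<dots> = B' (right_act scale \<Delta> w ?L)"
    by (rule balanced_right_act[OF B' bilinear_form_dual(2)[OF B(1)], symmetric])
  finally have "B x y = B' (right_act scale \<Delta> w ?L) x" for x
    by (rule fun_cong)
  then show ?thesis by blast
qed

lemma left_form_injective:
  assumes B: "is_bilinear scale scale (*) B" and nd: "non_degenerate B"
  shows "inj B"
proof (rule injI)
  fix a b assume eq: "B a = B b"
  have "B (a - b) x = 0" for x
  proof -
    have "B (a - b + b) x = B (a - b) x + B b x"
      using bilinear_form_dual(2)[OF B, of x] unfolding dual_iff by blast
    then show ?thesis by (simp add: eq)
  qed
  then have "a - b = 0" using nd unfolding non_degenerate_def by blast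
  then show "a = b" by simp
qed

lemma nakayama_eqI:
  assumes B: "is_bilinear scale scale (*) B" and nd: "non_degenerate B"
    and z: "\<And>x. B x y = B z x"
  shows "nakayama B y = z"
  unfolding nakayama_def
proof (rule the_equality)
  show "\<forall>x. B x y = B z x" using z by blast
next
  fix z' assume z': "\<forall>x. B x y = B z' x"
  have "B z' = B z"
  proof
    fix x
    show "B z' x = B z x" using z[of x] z' by metis
  qed
  then show "z' = z"
    by (rule injD[OF left_form_injective[OF B nd]])
qed

lemma nakayama_form:
  assumes "is_bilinear scale scale (*) B" "balanced scale \<Delta> B" "non_degenerate B"
  shows "B x y = B (nakayama B y) x"
proof -
  have "\<exists>z. \<forall>x. B x y = B z x"
    using assms(3) by (intro right_form_in_left_range[OF assms(1,2) assms(1,2)])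
      (simp add: non_degenerate_def)
  then obtain z where z: "\<And>x. B x y = B z x" by blast
  show ?thesis unfolding nakayama_eqI[OF assms(1,3) z] by (rule z)
qed

text \<open>
  By bilinearity over the dual algebra, \<open>\<phi> (x \<cdot> \<phi> y) = \<phi> x * \<phi> y = \<phi> (\<phi> x \<cdot> y)\<close>.  Cancel \<open>\<phi>\<close> and apply the
  counit.
\<close>

lemma bimodule_embedding_symmetric:
  assumes l: "left_module_hom scale \<Delta> \<phi>" and r: "right_module_hom scale \<Delta> \<phi>" and "inj \<phi>"
  shows "\<phi> x y = \<phi> y x"
proof -
  have d: "\<phi> z \<in> dual scale" for z
    using l unfolding left_module_hom_def linear_to_dual_def by blast
  have "\<phi> (right_act scale \<Delta> x (\<phi> y)) = \<phi> (left_act scale \<Delta> (\<phi> x) y)"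
    using l r d by (simp add: left_module_hom_def right_module_hom_def)
  then have "right_act scale \<Delta> x (\<phi> y) = left_act scale \<Delta> (\<phi> x) y"
    by (rule injD[OF \<open>inj \<phi>\<close>])
  then show ?thesis
    using counit_right_act[OF d, of x y] counit_left_act[OF d, of x y] by metis
qed


section \<open>Symmetry and the Nakayama automorphism\<close>

text \<open>
  The embedding is \<open>x \<mapsto> B(v \<cdot> x, -)\<close>.  Right linearity is visible, as the two actions commute; left
  linearity comes from rewriting it as \<open>B(-, x) * v\<close> by means of the formula for the Nakayama
  automorphism.
\<close>

lemma symmetric_if_nakayama_inner:
  assumes B: "is_bilinear scale scale (*) B" "balanced scale \<Delta> B" and nd: "non_degenerate B"
    and u: "u \<in> dual scale" and v: "v \<in> dual scale"
    and uv: "convolution \<Delta> u v = \<epsilon>"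
    and nak: "\<And>x. nakayama B x = right_act scale \<Delta> (left_act scale \<Delta> v x) u"
  shows "symmetric_coalgebra scale \<Delta>"
proof -
  define \<phi> where "\<phi> x = B (left_act scale \<Delta> v x)" for x
  note Bd = bilinear_form_dual[OF B(1)]
  have \<phi>_right: "\<phi> x = convolution \<Delta> (\<lambda>z. B z x) v" for x
  proof -
    have "(\<lambda>z. B z x) = B (right_act scale \<Delta> (left_act scale \<Delta> v x) u)"
      using nakayama_form[OF B nd, of _ x] by (simp add: nak fun_eq_iff)
    also have "\<dots> = convolution \<Delta> (\<phi> x) u"
      by (simp add: \<phi>_def balanced_right_act B u)
    finally show ?thesis
      by (simp add: convolution_assoc convolution_counit_right \<phi>_def Bd u v uv)
  qed
  have "(\<lambda>x. \<phi> x z) \<in> dual scale" for z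
    using Bd(2)[of z] by (simp add: dual_iff \<phi>_def linear_left_act[OF v])
  then have lin: "linear_to_dual scale \<phi>"
    using Bd(1) by (simp add: linear_to_dual_def \<phi>_def dual_def)
  have "left_module_hom scale \<Delta> \<phi>"
    using lin unfolding left_module_hom_def
    by (simp add: \<phi>_right balanced_left_act B convolution_assoc Bd v)
  moreover have "right_module_hom scale \<Delta> \<phi>"
    using lin unfolding right_module_hom_def
    by (simp add: \<phi>_def left_act_right_act[symmetric] balanced_right_act B v)
  moreover have "inj \<phi>"
  proof (rule injI)
    fix x y assume "\<phi> x = \<phi> y"
    then have "left_act scale \<Delta> v x = left_act scale \<Delta> v y"
      unfolding \<phi>_def by (rule injD[OF left_form_injective[OF B(1) nd]])
    then show "x = y"
      using left_act_left_act[OF u v] by (metis uv left_act_counit)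
  qed
  ultimately show ?thesis unfolding symmetric_coalgebra_def by blast
qed

text \<open>
  Both \<open>B(-, y)\<close> and \<open>B(x, -)\<close> are compared with the symmetric form \<open>\<phi>\<close>, for which left and right
  functionals coincide.  The two comparison maps are left and right linear respectively, hence given
  by elements \<open>u\<close> and \<open>v\<close> of the dual algebra, and composing them yields the Nakayama automorphism.
\<close>

lemma nakayama_inner_if_symmetric:
  assumes B: "is_bilinear scale scale (*) B" "balanced scale \<Delta> B" and nd: "non_degenerate B"
    and sym: "symmetric_coalgebra scale \<Delta>"
  shows "\<exists>u\<in>dual scale. \<exists>v\<in>dual scale. convolution \<Delta> u v = \<epsilon> \<and> convolution \<Delta> v u = \<epsilon> \<and>
    (\<forall>x. nakayama B x = right_act scale \<Delta> (left_act scale \<Delta> v x) u)"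
proof -
  obtain \<phi> where l: "left_module_hom scale \<Delta> \<phi>" and r: "right_module_hom scale \<Delta> \<phi>" and inj: "inj \<phi>"
    using sym by (auto simp: symmetric_coalgebra_def)
  have P: "is_bilinear scale scale (*) \<phi>" "balanced scale \<Delta> \<phi>"
    using l r right_module_hom_balanced by (auto simp: left_module_hom_def linear_to_dual_bilinear)
  note \<phi>_sym = bimodule_embedding_symmetric[OF l r inj]
  note Bd = bilinear_form_dual[OF B(1)] and Pd = bilinear_form_dual[OF P(1)]
  have \<phi>_left: "\<phi> (left_act scale \<Delta> f x) = convolution \<Delta> f (\<phi> x)"
    and \<phi>_right: "\<phi> (right_act scale \<Delta> x f) = convolution \<Delta> (\<phi> x) f" if "f \<in> dual scale" for f x
    using l r that by (simp_all add: left_module_hom_def right_module_hom_def)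
  have \<phi>_add: "\<phi> (x + y) z = \<phi> x z + \<phi> y z" and \<phi>_scale: "\<phi> (scale c x) z = c * \<phi> x z" for x y z c
    using Pd(2)[of z] by (auto simp: dual_iff)
  have B_add: "B (x + y) z = B x z + B y z" "B z (x + y) = B z x + B z y"
    and B_scale: "B (scale c x) z = c * B x z" "B z (scale c x) = c * B z x" for x y z c
    using Bd(2)[of z] Bd(1)[of z] by (auto simp: dual_iff)
  have ndr: "y = 0" if "\<forall>x. B x y = 0" for y using nd that unfolding non_degenerate_def by blast
  note B_inj = injD[OF left_form_injective[OF B(1) nd]]
  (* Injectivity makes \<phi> non-degenerate on the left; symmetry carries this over to the right. *)
  have "\<phi> 0 = (\<lambda>x. 0)"
    using \<phi>_scale[of 0 0] by auto
  then have \<phi>nd: "y = 0" if "\<forall>x. \<phi> x y = 0" for y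
    using that inj \<phi>_sym by (metis ext inj_eq)

  have "\<exists>c. \<forall>y x. B x y = \<phi> (c y) x"
    using right_form_in_left_range[OF B P \<phi>nd] by metis
  then obtain c where c: "\<And>y x. B x y = \<phi> (c y) x" by blast
  have "\<exists>a. \<forall>x z. \<phi> x z = B (a x) z"
    using right_form_in_left_range[OF P B ndr] \<phi>_sym by metis
  then obtain a where a: "\<And>x z. \<phi> x z = B (a x) z" by blast

  have cD: "\<epsilon> \<circ> c \<in> dual scale"
  proof -
    have "c (x + y) = c x + c y" for x y
      by (rule injD[OF inj]) (simp add: fun_eq_iff \<phi>_add c[symmetric] B_add)
    moreover have "c (scale d x) = scale d (c x)" for d x
      by (rule injD[OF inj]) (simp add: fun_eq_iff \<phi>_scale c[symmetric] B_scale)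
    ultimately show ?thesis using counit_dual by (simp add: dual_iff)
  qed
  have aD: "\<epsilon> \<circ> a \<in> dual scale"
  proof -
    have "a (x + y) = a x + a y" for x y
      by (rule B_inj) (simp_all add: fun_eq_iff B_add a[symmetric] \<phi>_add)
    moreover have "a (scale d x) = scale d (a x)" for d x
      by (rule B_inj) (simp_all add: fun_eq_iff B_scale a[symmetric] \<phi>_scale)
    ultimately show ?thesis using counit_dual by (simp add: dual_iff)
  qed
  define u where "u = \<epsilon> \<circ> c"
  define v where "v = \<epsilon> \<circ> a"
  have u: "u \<in> dual scale" and v: "v \<in> dual scale" using aD cD by (simp_all add: u_def v_def)

  have c_eq: "c y = right_act scale \<Delta> y u" for y
    unfolding u_def
  proof (rule left_linear_endomorphism[OF cD], rule injD[OF inj])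
    fix x f assume f: "f \<in> dual scale"
    have "(\<lambda>z. B z x) = \<phi> (c x)" by (simp add: c fun_eq_iff)
    then show "\<phi> (c (left_act scale \<Delta> f x)) = \<phi> (left_act scale \<Delta> f (c x))"
      using balanced_left_act[OF B f, of x] by (simp add: \<phi>_left f c fun_eq_iff)
  qed
  have a_eq: "a x = left_act scale \<Delta> v x" for x
    unfolding v_def
  proof (rule right_linear_endomorphism[OF aD], rule B_inj)
    fix x f assume f: "f \<in> dual scale"
    have "\<phi> x = B (a x)" for x by (simp add: a fun_eq_iff)
    then show "B (a (right_act scale \<Delta> x f)) = B (right_act scale \<Delta> (a x) f)"
      using \<phi>_right[OF f, of x] by (simp add: balanced_right_act B f)
  qed

  (* The identity B(x, y) = \<phi> (y . u) x, read as a functional of y by means of the symmetry of \<phi>. *)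
  have B_\<phi>: "B x = \<phi> (left_act scale \<Delta> u x)" for x
  proof
    fix y
    have "B x y = \<phi> x (right_act scale \<Delta> y u)"
      by (simp add: c c_eq \<phi>_sym)
    also have "\<dots> = \<phi> (left_act scale \<Delta> u x) y"
      by (simp add: dual_right_act Pd \<phi>_left u)
    finally show "B x y = \<phi> (left_act scale \<Delta> u x) y" .
  qed
  have \<phi>_B: "\<phi> x = B (left_act scale \<Delta> v x)" for x
    by (simp add: fun_eq_iff a a_eq)
  have "left_act scale \<Delta> u (left_act scale \<Delta> v x) = x" for x
    by (rule injD[OF inj]) (simp only: B_\<phi>[symmetric] \<phi>_B[symmetric])
  then have "convolution \<Delta> u v = \<epsilon>"
    using counit_left_act[OF convolution_dual[OF u v]] by (simp add: left_act_left_act u v fun_eq_iff)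
  moreover have "left_act scale \<Delta> v (left_act scale \<Delta> u x) = x" for x
    by (rule B_inj) (simp_all only: B_\<phi>[symmetric] \<phi>_B[symmetric])
  then have "convolution \<Delta> v u = \<epsilon>"
    using counit_left_act[OF convolution_dual[OF v u]] by (simp add: left_act_left_act u v fun_eq_iff)
  moreover have "nakayama B y = right_act scale \<Delta> (left_act scale \<Delta> v y) u" for y
  proof (rule nakayama_eqI[OF B(1) nd])
    fix x
    have "B x y = \<phi> (c y) x" by (rule c)
    then show "B x y = B (right_act scale \<Delta> (left_act scale \<Delta> v y) u) x"
      by (simp only: \<phi>_B c_eq left_act_right_act[OF v u])
  qed
  ultimately show ?thesis using u v by blast
qed

end

theorem proposition7p2:
  fixes scale :: "'k::field \<Rightarrow> 'c::ab_group_add \<Rightarrow> 'c"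
    and \<Delta> :: "'c \<Rightarrow> ('c \<times> 'c \<Rightarrow>\<^sub>0 'k) set"
    and \<epsilon> :: "'c \<Rightarrow> 'k"
    and B :: "'c \<Rightarrow> 'c \<Rightarrow> 'k"
  assumes "coalgebra scale \<Delta> \<epsilon>"
    and "co_frobenius scale \<Delta>"
    and "is_bilinear scale scale (*) B"
    and "balanced scale \<Delta> B"
    and "non_degenerate B"
  shows "symmetric_coalgebra scale \<Delta> \<longleftrightarrow>
    (\<exists>u\<in>dual scale. \<exists>v\<in>dual scale.
       convolution \<Delta> u v = \<epsilon> \<and> convolution \<Delta> v u = \<epsilon> \<and>
       (\<forall>x. nakayama B x = right_act scale \<Delta> (left_act scale \<Delta> v x) u))"
proof -
  interpret coalgebra scale \<Delta> \<epsilon> by fact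
  show ?thesis
    using nakayama_inner_if_symmetric[OF assms(3-5)] symmetric_if_nakayama_inner[OF assms(3-5)]
    by blast
qed

end
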